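(* Let $G\subset\mathbb{R}$ be a $G_\delta$-set. The following conditions are equivalent: (i) $\mathcal{C}_G$ is strongly $2^{\mathfrak{c}}$-algebrable; (ii) $\mathcal{C}_G$ is $\mathfrak{c}^+$-lineable; (iii) $\mathbb{R}\setminus G$ is $\mathfrak{c}$-dense in itself.
   Context: $\mathfrak{c}$ is the cardinality of the continuum and $\mathfrak{c}^+$ its cardinal successor. $\mathcal{C}_G$ is the set of all functions $f:\mathbb{R}\to\mathbb{R}$ whose set of continuity points equals $G$. A set $A\subset\mathbb{R}$ is $\mathfrak{c}$-dense in itself if $A$ is nonempty and for every open interval $J$ either $A\cap J=\emptyset$ or $|A\cap J|=\mathfrak{c}$. A subset $E$ of a vector space is $\lambda$-lineable if $E\cup\{0\}$ contains a linear subspace of dimension $\lambda$. A subset $E$ of the real algebra $\mathbb{R}^{\mathbb{R}}$ (pointwise operations) is strongly $\lambda$-algebrable if $E\cup\{0\}$ contains a free algebra with $\lambda$ free generators; equivalently, there is $Y\subset E$ with $|Y|=\lambda$ such that for every $n\geq1$, every nonzero real polynomial $P$ in $n$ variables without constant term and all distinct $y_1,\dots,y_n\in Y$ one has $P(y_1,\dots,y_n)\in E\setminus\{0\}$. *)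

theory Defs
  imports
    "HOL-Analysis.Analysis"
    "HOL-Library.Function_Algebras"
    "HOL-Library.Poly_Mapping"
begin

unbundle cardinal_syntax
no_notation Set_Algebras.elt_set_eq (infix \<open>=o\<close> 50)

instantiation "fun" :: (type, real_vector) real_vector
begin

definition "c *\<^sub>R f = (\<lambda>x. c *\<^sub>R f x)"

instance
  by standard (simp_all add: scaleR_fun_def fun_eq_iff scaleR_add_right scaleR_add_left)

end

lemma scaleR_fun_apply [simp]: "(c *\<^sub>R f) x = c *\<^sub>R f x"
  by (simp add: scaleR_fun_def)

instance "fun" :: (type, real_algebra) real_algebra
  by standard (simp_all add: fun_eq_iff)

instance "fun" :: (type, real_algebra_1) real_algebra_1 ..

text \<open>
  The library's dimension is a natural number, so an infinite dimension is given here as the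
  cardinality of a Hamel basis.
\<close>

definition lineable :: "'a::real_vector set \<Rightarrow> 'b rel \<Rightarrow> bool" where
  "lineable E \<kappa> \<longleftrightarrow>
    (\<exists>V B. subspace V \<and> V \<subseteq> E \<union> {0} \<and> independent B \<and> span B = V \<and> |B| =o \<kappa>)"

text \<open>
  Algebras here are not required to contain a unit, and the subalgebras below need not contain the
  unit of the ambient algebra; accordingly the relevant polynomials have no constant term.
\<close>

definition real_subalgebra :: "'a::real_algebra set \<Rightarrow> bool" where
  "real_subalgebra A \<longleftrightarrow> subspace A \<and> (\<forall>x\<in>A. \<forall>y\<in>A. x * y \<in> A)"

text \<open>
  A real polynomial maps each monomial to its coefficient, and a monomial maps each variable to its
  exponent; the variables are indexed by the natural numbers.
\<close>

type_synonym real_mpoly = "(nat \<Rightarrow>\<^sub>0 nat) \<Rightarrow>\<^sub>0 real"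

definition in_variables :: "nat \<Rightarrow> real_mpoly \<Rightarrow> bool" where
  "in_variables n P \<longleftrightarrow> (\<forall>m\<in>Poly_Mapping.keys P. Poly_Mapping.keys m \<subseteq> {..<n})"

definition no_constant_term :: "real_mpoly \<Rightarrow> bool" where
  "no_constant_term P \<longleftrightarrow> Poly_Mapping.lookup P 0 = 0"

definition monom_eval :: "(nat \<Rightarrow> 'a::comm_monoid_mult) \<Rightarrow> (nat \<Rightarrow>\<^sub>0 nat) \<Rightarrow> 'a" where
  "monom_eval y m = (\<Prod>i\<in>Poly_Mapping.keys m. y i ^ Poly_Mapping.lookup m i)"

definition mpoly_eval :: "(nat \<Rightarrow> 'a::{real_algebra_1, comm_ring_1}) \<Rightarrow> real_mpoly \<Rightarrow> 'a" where
  "mpoly_eval y P = (\<Sum>m\<in>Poly_Mapping.keys P. Poly_Mapping.lookup P m *\<^sub>R monom_eval y m)"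

definition free_generators :: "'a::{real_algebra_1, comm_ring_1} set \<Rightarrow> 'a set \<Rightarrow> bool" where
  "free_generators Y A \<longleftrightarrow> real_subalgebra hull Y = A \<and>
    (\<forall>n\<ge>1. \<forall>y P. inj_on y {..<n} \<and> y ` {..<n} \<subseteq> Y \<and>
       in_variables n P \<and> no_constant_term P \<and> P \<noteq> 0 \<longrightarrow> mpoly_eval y P \<noteq> 0)"

definition strongly_algebrable :: "'a::{real_algebra_1, comm_ring_1} set \<Rightarrow> 'b rel \<Rightarrow> bool" where
  "strongly_algebrable E \<kappa> \<longleftrightarrow>
    (\<exists>A Y. real_subalgebra A \<and> A \<subseteq> E \<union> {0} \<and> free_generators Y A \<and> |Y| =o \<kappa>)"

lemma mpoly_eval_superset:
  assumes "finite K" "Poly_Mapping.keys P \<subseteq> K"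
  shows "mpoly_eval y P = (\<Sum>m\<in>K. Poly_Mapping.lookup P m *\<^sub>R monom_eval y m)"
  unfolding mpoly_eval_def using assms
  by (intro sum.mono_neutral_left) (auto simp: in_keys_iff)

lemma mpoly_eval_add: "mpoly_eval y (P + Q) = mpoly_eval y P + mpoly_eval y Q"
proof -
  let ?K = "Poly_Mapping.keys P \<union> Poly_Mapping.keys Q"
  have "Poly_Mapping.keys (P + Q) \<subseteq> ?K"
    by (rule Poly_Mapping.keys_add)
  then show ?thesis
    by (simp add: mpoly_eval_superset[of ?K] lookup_add scaleR_add_left sum.distrib)
qed

lemma mpoly_eval_single: "mpoly_eval y (Poly_Mapping.single m c) = c *\<^sub>R monom_eval y m"
  by (simp add: mpoly_eval_def)

lemma monom_eval_in_subalgebra: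
  fixes A :: "'a::{real_algebra_1, comm_ring_1} set"
  assumes A: "real_subalgebra A" and y: "y ` Poly_Mapping.keys m \<subseteq> A" and m: "m \<noteq> 0"
  shows "monom_eval y m \<in> A"
proof -
  have mult: "a * b \<in> A" if "a \<in> A" "b \<in> A" for a b
    using A that by (auto simp: real_subalgebra_def)
  have pow: "a ^ Suc k \<in> A" if "a \<in> A" for a k
    using that by (induction k) (auto intro: mult)
  have "(\<Prod>i\<in>I. y i ^ Poly_Mapping.lookup m i) \<in> A"
    if "finite I" "I \<noteq> {}" "I \<subseteq> Poly_Mapping.keys m" for I
    using that
  proof (induction rule: finite_ne_induct)
    case (singleton i)
    then obtain k where "Poly_Mapping.lookup m i = Suc k"
      by (metis in_keys_iff insert_subset not0_implies_Suc)
    then show ?case using pow[of "y i" k] y singleton by auto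
  next
    case (insert i F)
    then obtain k where "Poly_Mapping.lookup m i = Suc k"
      by (metis in_keys_iff insert_subset not0_implies_Suc)
    then have "y i ^ Poly_Mapping.lookup m i \<in> A" using pow[of "y i" k] y insert by auto
    then show ?case using insert by (auto intro: mult)
  qed
  from this[of "Poly_Mapping.keys m"] m show ?thesis
    by (simp add: monom_eval_def)
qed

lemma mpoly_eval_in_subalgebra:
  assumes A: "real_subalgebra A" and y: "y ` {..<n} \<subseteq> A"
    and P: "in_variables n P" "no_constant_term P"
  shows "mpoly_eval y P \<in> A"
proof -
  have sub: "subspace A" using A by (simp add: real_subalgebra_def)
  have "monom_eval y m \<in> A" if m: "m \<in> Poly_Mapping.keys P" for m
  proof (rule monom_eval_in_subalgebra[OF A])
    show "y ` Poly_Mapping.keys m \<subseteq> A"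
      using P(1) y m by (fastforce simp: in_variables_def)
    show "m \<noteq> 0"
      using P(2) m by (auto simp: no_constant_term_def in_keys_iff)
  qed
  then show ?thesis unfolding mpoly_eval_def
    by (intro subspace_sum[OF sub] subspace_scale[OF sub])
qed

lemma real_subalgebra_hull: "real_subalgebra (real_subalgebra hull Y)"
  by (rule hull_in) (auto simp: real_subalgebra_def intro: subspace_Inter)

lemma hull_elem_is_mpoly_eval:
  fixes Y :: "'a::{real_algebra_1, comm_ring_1} set"
  assumes v: "v \<in> real_subalgebra hull Y"
  obtains n y P where "inj_on y {..<n}" "y ` {..<n} \<subseteq> Y" "in_variables n P" "no_constant_term P"
    "v = mpoly_eval y P"
proof -
  define mon :: "'a set \<Rightarrow> ('a \<Rightarrow> nat) \<Rightarrow> 'a" where "mon F e = (\<Prod>x\<in>F. x ^ e x)" for F e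
  define M where "M = {mon F e |F e. finite F \<and> F \<subseteq> Y \<and> (\<exists>x\<in>F. e x \<noteq> 0)}"
  have mon_superset: "mon F e = mon U (\<lambda>x. if x \<in> F then e x else 0)"
    if "finite U" "F \<subseteq> U" for F U e
    unfolding mon_def using that by (intro prod.mono_neutral_cong_left) auto
  have M_mult: "a * b \<in> M" if ab: "a \<in> M" "b \<in> M" for a b
  proof -
    obtain F e F' e' where F: "a = mon F e" "finite F" "F \<subseteq> Y" "\<exists>x\<in>F. e x \<noteq> 0"
      and F': "b = mon F' e'" "finite F'" "F' \<subseteq> Y"
      using ab unfolding M_def by blast
    let ?e = "\<lambda>x. (if x \<in> F then e x else 0) + (if x \<in> F' then e' x else 0)"
    have "mon F e = mon (F \<union> F') (\<lambda>x. if x \<in> F then e x else 0)"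
      "mon F' e' = mon (F \<union> F') (\<lambda>x. if x \<in> F' then e' x else 0)"
      using F F' by (auto intro!: mon_superset)
    then have "a * b = mon (F \<union> F') ?e"
      unfolding F(1) F'(1) by (simp only: mon_def prod.distrib[symmetric] power_add)
    moreover have "\<exists>x\<in>F \<union> F'. ?e x \<noteq> 0" using F by auto
    ultimately show ?thesis
      unfolding M_def using F F' by (intro CollectI exI[of _ "F \<union> F'"] exI[of _ ?e]) auto
  qed
  have span_mult1: "a * b \<in> span M" if "a \<in> span M" "b \<in> M" for a b
    using that(1)
  proof (induction rule: span_induct_alt)
    case base
    then show ?case by (simp add: span_zero)
  next
    case (step c x z)
    then show ?case using M_mult[OF _ that(2), of x]
      by (simp add: distrib_right span_add span_scale span_base)
  qed
  have span_mult: "a * b \<in> span M" if a: "a \<in> span M" and b: "b \<in> span M" for a b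
    using b
  proof (induction rule: span_induct_alt)
    case base
    then show ?case by (simp add: span_zero)
  next
    case (step c x z)
    then show ?case using span_mult1[OF a, of x]
      by (simp add: distrib_left span_add span_scale)
  qed
  have "real_subalgebra (span M)"
    using span_mult by (auto simp: real_subalgebra_def subspace_span)
  moreover have "Y \<subseteq> span M"
  proof
    fix x assume "x \<in> Y"
    then have "x \<in> M" unfolding M_def
      by (intro CollectI exI[of _ "{x}"] exI[of _ "\<lambda>_. 1"]) (auto simp: mon_def)
    then show "x \<in> span M" by (rule span_base)
  qed
  ultimately have "real_subalgebra hull Y \<subseteq> span M"
    by (intro hull_minimal)
  with v have "v \<in> span M" by auto
  then obtain T c where T: "finite T" "T \<subseteq> M" "v = (\<Sum>a\<in>T. c a *\<^sub>R a)"
    unfolding span_explicit by auto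
  have "\<forall>a\<in>T. \<exists>F e. a = mon F e \<and> finite F \<and> F \<subseteq> Y \<and> (\<exists>x\<in>F. e x \<noteq> 0)"
    using T(2) by (auto simp: M_def)
  then obtain F e where Fe:
    "\<And>a. a \<in> T \<Longrightarrow> a = mon (F a) (e a) \<and> finite (F a) \<and> F a \<subseteq> Y \<and> (\<exists>x\<in>F a. e a x \<noteq> 0)"
    by metis
  define U where "U = (\<Union>a\<in>T. F a)"
  have U: "finite U" "U \<subseteq> Y" using T Fe by (auto simp: U_def)
  obtain y where y: "bij_betw y {..<card U} U"
    using ex_bij_betw_nat_finite[OF U(1)] by (auto simp: atLeast0LessThan)
  let ?n = "card U"
  define R where "R = {mpoly_eval y P |P. in_variables ?n P \<and> no_constant_term P}"
  have R_add: "a + b \<in> R" if ab: "a \<in> R" "b \<in> R" for a b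
  proof -
    obtain P Q where "a = mpoly_eval y P" "b = mpoly_eval y Q"
      "in_variables ?n P" "no_constant_term P" "in_variables ?n Q" "no_constant_term Q"
      using ab by (auto simp: R_def)
    then show ?thesis unfolding R_def
      using Poly_Mapping.keys_add[of P Q]
      by (intro CollectI exI[of _ "P + Q"])
         (auto simp: mpoly_eval_add in_variables_def no_constant_term_def lookup_add)
  qed
  have R_zero: "0 \<in> R" unfolding R_def
    by (intro CollectI exI[of _ 0])
       (auto simp: mpoly_eval_def in_variables_def no_constant_term_def)
  have R_mon: "k *\<^sub>R a \<in> R" if a: "a \<in> T" for a k
  proof -
    have FU: "F a \<subseteq> U" using a by (auto simp: U_def)
    define d where "d x = (if x \<in> F a then e a x else 0)" for x
    define f where "f i = (if i < ?n then d (y i) else 0)" for i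
    have fin: "finite {i. f i \<noteq> 0}"
      by (rule finite_subset[of _ "{..<?n}"]) (auto simp: f_def split: if_splits)
    define m where "m = Abs_poly_mapping f"
    have lm: "Poly_Mapping.lookup m = f"
      unfolding m_def using fin by simp
    have km: "Poly_Mapping.keys m \<subseteq> {..<?n}"
      by (auto simp: in_keys_iff lm f_def split: if_splits)
    have "monom_eval y m = (\<Prod>i<?n. y i ^ d (y i))"
      unfolding monom_eval_def
      by (intro prod.mono_neutral_cong_left) (use km in \<open>auto simp: lm in_keys_iff f_def\<close>)
    also have "\<dots> = mon U d"
      unfolding mon_def by (rule prod.reindex_bij_betw[OF y])
    also have "\<dots> = mon (F a) (e a)"
      using mon_superset[OF U(1) FU, of "e a"] by (simp add: d_def[abs_def])
    also have "\<dots> = a" using Fe[OF a] by simp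
    finally have eval: "monom_eval y m = a" .
    obtain x where x: "x \<in> F a" "e a x \<noteq> 0" using Fe[OF a] by auto
    then have "x \<in> y ` {..<?n}" using FU y by (auto simp: bij_betw_def)
    then obtain i where "i < ?n" "y i = x" by blast
    then have "Poly_Mapping.lookup m i \<noteq> 0" using x by (simp add: lm f_def d_def)
    then have "m \<noteq> 0" by auto
    then show ?thesis unfolding R_def
      using km eval
      by (intro CollectI exI[of _ "Poly_Mapping.single m k"])
         (auto simp: mpoly_eval_single in_variables_def no_constant_term_def lookup_single when_def
            split: if_splits)
  qed
  have "(\<Sum>a\<in>S. c a *\<^sub>R a) \<in> R" if "S \<subseteq> T" for S
    using finite_subset[OF that T(1)] that
    by (induction rule: finite_induct) (auto intro: R_zero R_add R_mon)
  then have "v \<in> R" using T by auto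
  then obtain P where "v = mpoly_eval y P" "in_variables ?n P" "no_constant_term P"
    unfolding R_def by blast
  moreover have "inj_on y {..<?n}" "y ` {..<?n} \<subseteq> Y"
    using y U(2) by (auto simp: bij_betw_def)
  ultimately show ?thesis by (intro that)
qed

text \<open>
  A generating set of a free algebra contained in \<open>E \<union> {0}\<close> can be recognized by evaluating polynomials
  on tuples of distinct elements.
\<close>

lemma strongly_algebrable_iff_polynomial:
  fixes E :: "'a::{real_algebra_1, comm_ring_1} set"
  shows "strongly_algebrable E \<kappa> \<longleftrightarrow>
    (\<exists>Y\<subseteq>E. |Y| =o \<kappa> \<and>
      (\<forall>n\<ge>1. \<forall>y P. inj_on y {..<n} \<and> y ` {..<n} \<subseteq> Y \<and>
         in_variables n P \<and> no_constant_term P \<and> P \<noteq> 0 \<longrightarrow> mpoly_eval y P \<in> E - {0}))"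
    (is "?L \<longleftrightarrow> ?R")
proof
  assume ?L
  then obtain A Y where A: "real_subalgebra A" "A \<subseteq> E \<union> {0}"
    and gen: "free_generators Y A" and card: "|Y| =o \<kappa>"
    unfolding strongly_algebrable_def by (elim exE conjE)
  have hull: "real_subalgebra hull Y = A"
    using gen unfolding free_generators_def by (rule conjunct1)
  have free: "mpoly_eval y P \<noteq> 0"
    if "1 \<le> n" "inj_on y {..<n}" "y ` {..<n} \<subseteq> Y" "in_variables n P" "no_constant_term P" "P \<noteq> 0"
    for n y P
    using gen[unfolded free_generators_def, THEN conjunct2, rule_format, of n y P] that by simp
  have YA: "Y \<subseteq> A" using hull hull_subset[of Y real_subalgebra] by simp
  have "x \<in> E" if x: "x \<in> Y" for x
  proof -
    let ?P = "Poly_Mapping.single (Poly_Mapping.single 0 1) 1 :: real_mpoly"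
    have "Poly_Mapping.lookup ?P (Poly_Mapping.single 0 1) = 1" by simp
    then have "?P \<noteq> 0" by (metis lookup_zero zero_neq_one)
    moreover have "Poly_Mapping.single (0::nat) (1::nat) \<noteq> 0"
      by (metis lookup_single_eq lookup_zero zero_neq_one)
    ultimately have "mpoly_eval (\<lambda>_. x) ?P \<noteq> 0"
      by (intro free[of 1])
         (auto simp: x in_variables_def no_constant_term_def lookup_single when_def inj_on_def)
    then have "x \<noteq> 0" by (simp add: mpoly_eval_single monom_eval_def)
    with x YA A(2) show ?thesis by auto
  qed
  moreover have "mpoly_eval y P \<in> E - {0}"
    if "1 \<le> n" "inj_on y {..<n}" "y ` {..<n} \<subseteq> Y" "in_variables n P" "no_constant_term P" "P \<noteq> 0"
    for n y P
    using mpoly_eval_in_subalgebra[OF A(1), of y n P] free[OF that] that YA A(2) by auto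
  ultimately show ?R using card by (intro exI[of _ Y] conjI allI impI) auto
next
  assume ?R
  then obtain Y where Y: "Y \<subseteq> E" "|Y| =o \<kappa>"
    and indep: "\<forall>n\<ge>1. \<forall>y P. inj_on y {..<n} \<and> y ` {..<n} \<subseteq> Y \<and>
      in_variables n P \<and> no_constant_term P \<and> P \<noteq> 0 \<longrightarrow> mpoly_eval y P \<in> E - {0}"
    by (elim exE conjE)
  have free: "mpoly_eval y P \<in> E - {0}"
    if "1 \<le> n" "inj_on y {..<n}" "y ` {..<n} \<subseteq> Y" "in_variables n P" "no_constant_term P" "P \<noteq> 0"
    for n y P
    using indep[rule_format, of n y P] that by simp
  have "v \<in> E \<union> {0}" if v: "v \<in> real_subalgebra hull Y" for v
  proof -
    obtain n y P where P: "inj_on y {..<n}" "y ` {..<n} \<subseteq> Y" "in_variables n P"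
      "no_constant_term P" "v = mpoly_eval y P"
      using hull_elem_is_mpoly_eval[OF v] .
    show ?thesis
    proof (cases "P = 0")
      case True
      then show ?thesis using P by (simp add: mpoly_eval_def)
    next
      case False
      then obtain m where m: "m \<in> Poly_Mapping.keys P" by (metis keys_eq_empty all_not_in_conv)
      then have "m \<noteq> 0" using P(4) by (auto simp: no_constant_term_def in_keys_iff)
      then have "Poly_Mapping.keys m \<noteq> {}" by simp
      then have "n \<ge> 1" using P(3) m by (cases n) (auto simp: in_variables_def)
      then show ?thesis using free[OF _ P(1-4) False] P(5) by auto
    qed
  qed
  then have "real_subalgebra hull Y \<subseteq> E \<union> {0}" by (rule subsetI)
  moreover have "free_generators Y (real_subalgebra hull Y)"
    unfolding free_generators_def using indep by auto
  ultimately show ?L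
    unfolding strongly_algebrable_def using Y(2) real_subalgebra_hull[of Y]
    by (intro exI[of _ "real_subalgebra hull Y"] exI[of _ Y] conjI)
qed

definition continuity_class :: "real set \<Rightarrow> (real \<Rightarrow> real) set" where
  "continuity_class G = {f. {x. isCont f x} = G}"

definition continuum_dense_in_itself :: "real set \<Rightarrow> bool" where
  "continuum_dense_in_itself A \<longleftrightarrow> A \<noteq> {} \<and>
    (\<forall>J. open J \<and> is_interval J \<longrightarrow> A \<inter> J = {} \<or> |A \<inter> J| =o |UNIV :: real set| )"

end

theory Submission
  imports Defs
begin

text \<open>
  Put \<open>F = - G\<close>, an \<open>F\<^sub>\<sigma>\<close> set; by the perfect set theorem its intersection with an open set is
  countable or has the size of the continuum.

  If \<open>F\<close> is not \<open>\<cc>\<close>-dense in itself, then either \<open>F\<close> is empty (take \<open>J = \<real>\<close>) or some open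
  interval \<open>J\<close> meets \<open>F\<close> in a nonempty countable set. A function that is continuous on \<open>G\<close> is
  determined on \<open>J\<close> by its values on the countable set consisting of \<open>F \<inter> J\<close> and a dense subset of
  \<open>G \<inter> J\<close>. There are only \<open>\<cc>\<close> such restrictions, so two of \<open>\<cc>\<^sup>+\<close> independent functions have a
  difference vanishing on \<open>J\<close>, which is continuous on \<open>J\<close>: a contradiction.

  If \<open>F\<close> is \<open>\<cc>\<close>-dense in itself, cover it by countably many closed sets \<open>K\<^sub>n \<subseteq> F\<close> such that each point
  of \<open>F\<close> is a condensation point of some \<open>K\<^sub>n\<close>. The function \<open>h\<close> that vanishes on \<open>G\<close> and is
  \<open>1 / (n + 1)\<close> where \<open>K\<^sub>n\<close> is the first set containing the point is continuous on \<open>G\<close>. Truncate to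
  \<open>[-h, h]\<close> an independent family of \<open>2\<close> to the \<open>\<cc>\<close> functions, any finitely many of which jointly
  attain all real tuples on each uncountable piece of each \<open>K\<^sub>n\<close>. A polynomial without constant term
  in such functions is continuous on \<open>G\<close>, but near a condensation point of \<open>K\<^sub>n\<close> it attains both
  \<open>0\<close> and a fixed nonzero value, because a nonzero polynomial does not vanish on a cube around \<open>0\<close>.
\<close>

section \<open>Sets of at most continuum size and simultaneous surjections\<close>

text \<open>Reals are coded by sets of naturals, and \<open>prod_encode\<close> packs a sequence of
  such sets into a single one, slice by slice.\<close>

lemma card_of_nat_fun_real: "|UNIV :: (nat \<Rightarrow> real) set| \<le>o |UNIV :: real set|"
proof -
  obtain e :: "real \<Rightarrow> nat set" where e: "inj e"
    using nat_sets_eqpoll_reals by (meson bij_betw_def eqpoll_def eqpoll_sym)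
  have nr: "|UNIV :: nat set set| =o |UNIV :: real set|"
    using nat_sets_eqpoll_reals by (simp add: eqpoll_iff_card_of_ordIso)
  define g where "g f = {prod_encode (n, m) |n m. m \<in> e (f n)}" for f :: "nat \<Rightarrow> real"
  have "inj g"
  proof (rule injI, rule ext)
    fix f f' n assume eq: "g f = g f'"
    have "m \<in> e (u n) \<longleftrightarrow> prod_encode (n, m) \<in> g u" for m u
      by (auto simp: g_def)
    then have "e (f n) = e (f' n)" using eq by blast
    then show "f n = f' n" using e by (simp add: inj_eq)
  qed
  then have "|UNIV :: (nat \<Rightarrow> real) set| \<le>o |UNIV :: nat set set|"
    using card_of_ordLeq by blast
  then show ?thesis using nr ordLeq_ordIso_trans by blast
qed

lemma card_of_list_le_real:
  assumes "|UNIV :: 'a set| \<le>o |UNIV :: real set|"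
  shows "|UNIV :: 'a list set| \<le>o |UNIV :: real set|"
proof -
  obtain e :: "'a \<Rightarrow> real" where e: "inj e"
    using assms card_of_ordLeq[of "UNIV :: 'a set" "UNIV :: real set"] by auto
  \<comment> \<open>The length comes first, so that the zero padding cannot be mistaken for entries;
    the entries are shifted by one.\<close>
  define g where "g xs n = (if n = 0 then real (length xs)
      else if n \<le> length xs then e (xs ! (n - 1)) else 0)" for xs n
  have "inj g"
  proof (rule injI)
    fix xs ys assume eq: "g xs = g ys"
    from fun_cong[OF eq, of 0] have len: "length xs = length ys" by (simp add: g_def)
    show "xs = ys"
    proof (rule nth_equalityI[OF len])
      fix i assume "i < length xs"
      then show "xs ! i = ys ! i"
        using fun_cong[OF eq, of "Suc i"] len e by (simp add: g_def inj_eq)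
    qed
  qed
  then have "|UNIV :: 'a list set| \<le>o |UNIV :: (nat \<Rightarrow> real) set|"
    using card_of_ordLeq by blast
  then show ?thesis using card_of_nat_fun_real ordLeq_transitive by blast
qed

lemma countable_card_le_real:
  assumes "countable A"
  shows "|A| \<le>o |UNIV :: real set|"
proof -
  have "inj (real :: nat \<Rightarrow> real)" by (simp add: inj_on_def)
  then have "inj_on (real \<circ> to_nat_on A) A"
    by (intro comp_inj_on inj_on_to_nat_on assms) (auto simp: inj_on_def)
  then show ?thesis using card_of_ordLeq by blast
qed

text \<open>This allows one index map to be onto on countably many sets at once. Transfinite
  recursion along a well-order of minimal type on the pairs \<open>(k, i)\<close> picks distinct
  points \<open>e (k, i)\<close> of \<open>B k\<close>: at each stage fewer points have been used
  than \<open>B k\<close> contains. Sending \<open>e (k, i)\<close> to \<open>i\<close> is then well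
  defined.\<close>

lemma common_surjection:
  fixes B :: "'k::countable \<Rightarrow> 'a set"
  assumes inf: "infinite (UNIV :: 'i set)"
    and B: "\<And>k. |UNIV :: 'i set| \<le>o |B k|"
  shows "\<exists>\<sigma> :: 'a \<Rightarrow> 'i. \<forall>k. \<sigma> ` B k = UNIV"
proof -
  let ?r = "|UNIV :: ('k \<times> 'i) set|"
  have wo: "Well_order ?r" by (rule card_of_Well_order)
  have "|UNIV :: 'k set| \<le>o |UNIV :: nat set|"
    using card_of_ordLeq[of "UNIV :: 'k set" "UNIV :: nat set"] inj_to_nat by auto
  also have "|UNIV :: nat set| \<le>o |UNIV :: 'i set|"
    using inf by (simp add: infinite_iff_card_of_nat)
  finally have "|(UNIV :: 'k set) \<times> (UNIV :: 'i set)| =o |UNIV :: 'i set|"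
    using inf card_of_Times_infinite by blast
  then have r: "?r \<le>o |B k|" for k
    using B[of k] by (metis UNIV_Times_UNIV ordIso_ordLeq_trans)
  define P where "P f z v \<longleftrightarrow> v \<in> B (fst z) - f ` underS ?r z" for f z v
  have "\<exists>e. \<forall>z. P e z (e z)"
  proof (rule dependent_wf_choice[of "?r - Id"])
    show "wf (?r - Id)" using wo by (simp add: well_order_on_def)
  next
    fix f g z v assume eq: "\<And>w. (w, z) \<in> ?r - Id \<Longrightarrow> f w = (g w :: 'a)"
    have "f ` underS ?r z = g ` underS ?r z"
      by (rule image_cong) (auto simp: underS_def intro: eq)
    then show "P f z v = P g z v" by (simp add: P_def)
  next
    fix z and f :: "'k \<times> 'i \<Rightarrow> 'a"
    have "|f ` underS ?r z| \<le>o |underS ?r z|" by (rule card_of_image)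
    also have "|underS ?r z| <o ?r"
      by (rule card_of_underS[OF card_of_Card_order]) (simp add: Field_card_of)
    also have "?r \<le>o |B (fst z)|" by (rule r)
    finally have "\<not> B (fst z) \<subseteq> f ` underS ?r z"
      using card_of_mono1 not_ordLess_ordLeq by blast
    then show "\<exists>v. P f z v" by (auto simp: P_def)
  qed
  then obtain e where P: "\<And>z. P e z (e z)" by blast
  have e: "e z \<in> B (fst z)" "w \<in> underS ?r z \<Longrightarrow> e w \<noteq> e z" for z w
    using P[of z] imageI[of w _ e] unfolding P_def by (blast, metis DiffD2)
  have "inj e"
  proof (rule injI, rule ccontr)
    fix w z assume "e w = e z" "w \<noteq> z"
    moreover have "(w, z) \<in> ?r \<or> (z, w) \<in> ?r"
      using wo \<open>w \<noteq> z\<close> unfolding well_order_on_def linear_order_on_def total_on_def Field_card_of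
      by blast
    ultimately show False using e(2)[of w z] e(2)[of z w] by (auto simp: underS_def)
  qed
  then have "snd (inv e (e (k, i))) = i" for k i by simp
  moreover have "e (k, i) \<in> B k" for k i using e(1)[of "(k, i)"] by simp
  ultimately have "(\<lambda>x. snd (inv e x)) ` B k = UNIV" for k by (metis UNIV_eq_I image_eqI)
  then show ?thesis by blast
qed

section \<open>Condensation points and the size of uncountable F-sigma sets\<close>

text \<open>Each such point lies in a basic open set that meets \<open>S\<close> in a countable set,
  and a countable base has only countably many of these.\<close>

lemma countable_noncondensation:
  fixes S :: "'a::second_countable_topology set"
  shows "countable {x\<in>S. \<exists>U. open U \<and> x \<in> U \<and> countable (S \<inter> U)}" (is "countable ?N")
proof -
  obtain \<B> :: "'a set set" where \<B>: "countable \<B>" "\<And>C. C \<in> \<B> \<Longrightarrow> open C"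
    "\<And>U. open U \<Longrightarrow> \<exists>\<U>. \<U> \<subseteq> \<B> \<and> U = \<Union>\<U>"
    using univ_second_countable by metis
  have "?N \<subseteq> (\<Union>C\<in>{C\<in>\<B>. countable (S \<inter> C)}. S \<inter> C)"
  proof
    fix x assume "x \<in> ?N"
    then obtain U where U: "x \<in> S" "open U" "x \<in> U" "countable (S \<inter> U)" by auto
    then obtain C where "C \<in> \<B>" "x \<in> C" "C \<subseteq> U" using \<B>(3)[of U] by blast
    moreover from this U(4) have "countable (S \<inter> C)" by (meson Int_mono countable_subset subset_refl)
    ultimately show "x \<in> (\<Union>C\<in>{C\<in>\<B>. countable (S \<inter> C)}. S \<inter> C)" using U(1) by blast
  qed
  moreover have "countable (\<Union>C\<in>{C\<in>\<B>. countable (S \<inter> C)}. S \<inter> C)"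
    using \<B>(1) by (intro countable_UN) auto
  ultimately show ?thesis by (rule countable_subset)
qed

text \<open>As in the Cantor-Bendixson theorem, deleting the countably many points of
  \<open>S\<close> that are not condensation points leaves a nonempty perfect set, to which the
  perfect set theorem applies.\<close>

lemma uncountable_closed_card:
  fixes S :: "real set"
  assumes "closed S" "uncountable S"
  shows "|S| =o |UNIV :: real set|"
proof -
  define N where "N = {x\<in>S. \<exists>U. open U \<and> x \<in> U \<and> countable (S \<inter> U)}"
  have N: "countable N" unfolding N_def by (rule countable_noncondensation)
  define T where "T = S - N"
  have T: "T \<noteq> {}" using N assms(2) T_def by (metis Diff_eq_empty_iff countable_subset)
  have dense: "x islimpt T" if x: "x \<in> T" for x
    unfolding islimpt_def
  proof (intro allI impI)
    fix U assume "x \<in> U" "open U"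
    with x have "uncountable (S \<inter> U)" by (auto simp: T_def N_def)
    then have "uncountable ((S \<inter> U) - insert x N)" using N by (simp add: uncountable_minus_countable)
    then obtain y where "y \<in> (S \<inter> U) - insert x N" by (metis countable_empty ex_in_conv)
    then show "\<exists>y\<in>T. y \<in> U \<and> y \<noteq> x" by (auto simp: T_def)
  qed
  have "x \<in> T" if x: "x islimpt T" for x
  proof -
    have "x islimpt S" using x by (rule islimpt_subset) (auto simp: T_def)
    then have "x \<in> S" using assms(1) closed_limpt by blast
    moreover have "x \<notin> N"
    proof
      assume "x \<in> N"
      then obtain U where U: "open U" "x \<in> U" "countable (S \<inter> U)" by (auto simp: N_def)
      then obtain y where "y \<in> T" "y \<in> U" using x unfolding islimpt_def by blast
      then show False using U by (auto simp: T_def N_def)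
    qed
    ultimately show ?thesis by (simp add: T_def)
  qed
  then have "{x. x islimpt T} = T" using dense by blast
  moreover have "euclidean derived_set_of T = {x. x islimpt T}"
    by (auto simp only: derived_set_of_def islimpt_def open_openin topspace_euclidean UNIV_I)
  ultimately have "euclidean derived_set_of T = T" by simp
  then have "(UNIV :: real set) \<lesssim> T"
    using T completely_metrizable_space_euclidean
    by (intro lepoll_perfect_set[of euclidean]) auto
  also have "T \<lesssim> S" by (rule subset_imp_lepoll) (auto simp: T_def)
  finally have "S \<approx> (UNIV :: real set)"
    by (rule lepoll_antisym[OF subset_imp_lepoll[OF subset_UNIV]])
  then show ?thesis by (simp add: eqpoll_iff_card_of_ordIso)
qed

lemma uncountable_fsigma_contains_closed:
  fixes S :: "'a::topological_space set"
  assumes "fsigma_in euclidean S" "uncountable S"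
  obtains C where "closed C" "C \<subseteq> S" "uncountable C"
proof -
  obtain C :: "nat \<Rightarrow> 'a set" where C: "\<And>n. closed (C n)" "\<Union> (range C) = S"
    using assms(1) unfolding fsigma_in_ascending closed_closedin by metis
  then have "\<exists>n::nat. uncountable (C n)"
    using assms(2) by (metis countable_UN countableI_type)
  with C that show ?thesis by blast
qed

text \<open>An uncountable closed part already has the size of the continuum. So an F-sigma set of
  smaller size is countable, without the continuum hypothesis.\<close>

lemma uncountable_fsigma_card:
  fixes S :: "real set"
  assumes "fsigma_in euclidean S" "uncountable S"
  shows "|S| =o |UNIV :: real set|"
proof -
  obtain C where C: "closed C" "C \<subseteq> S" "uncountable C"
    using uncountable_fsigma_contains_closed[OF assms] .
  then have "|UNIV :: real set| \<le>o |S|"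
    using uncountable_closed_card[of C] card_of_mono1[of C S] ordIso_ordLeq_trans ordIso_symmetric
    by blast
  then show ?thesis by (simp add: ordIso_iff_ordLeq card_of_mono1)
qed

lemma fsigma_in_open: "open S \<Longrightarrow> fsigma_in euclidean (S :: 'a::metric_space set)"
  by (simp add: open_imp_fsigma_in metrizable_space_euclidean)

lemma fsigma_complement:
  assumes "gdelta_in euclidean G"
  shows "fsigma_in euclidean (- G)"
  using assms by (simp add: gdelta_in_fsigma_in Compl_eq_Diff_UNIV)

section \<open>Independent families and nonvanishing of polynomials near zero\<close>

text \<open>
  An independent family in the sense of Fichtenholz, Kantorovich and Hausdorff, with arbitrary values
  instead of two: an index consists of a list of sample points and a finite table, and \<open>X\<close> is
  evaluated by looking up its membership pattern on the sample points.
\<close>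

definition separating_value :: "'a set \<Rightarrow> 'a list \<times> (bool list \<times> 'b::zero) list \<Rightarrow> 'b" where
  "separating_value X = (\<lambda>(S, T).
    case map_of T (map (\<lambda>s. s \<in> X) S) of Some v \<Rightarrow> v | None \<Rightarrow> 0)"

text \<open>Sample points that distinguish every two of the finitely many sets give these sets
  distinct membership patterns, so one table can assign them arbitrary values.\<close>

lemma separating_value_surj:
  fixes X :: "nat \<Rightarrow> 'a set" and a :: "nat \<Rightarrow> 'b::zero"
  assumes "inj_on X {..<n}"
  shows "\<exists>i. \<forall>j<n. separating_value (X j) i = a j"
proof -
  have "\<exists>s. X j \<noteq> X k \<longrightarrow> (s \<in> X j \<longleftrightarrow> s \<notin> X k)" for j k by blast
  then obtain s where s: "\<And>j k. X j \<noteq> X k \<Longrightarrow> s j k \<in> X j \<longleftrightarrow> s j k \<notin> X k" by metis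
  define S where "S = map (\<lambda>(j, k). s j k) (List.product [0..<n] [0..<n])"
  define pat where "pat j = map (\<lambda>s. s \<in> X j) S" for j
  have "inj_on pat {..<n}"
  proof (rule inj_onI, rule ccontr)
    fix j k assume jk: "j \<in> {..<n}" "k \<in> {..<n}" "pat j = pat k" "j \<noteq> k"
    then have "s j k \<in> set S" by (force simp: S_def)
    moreover have "X j \<noteq> X k" using assms jk by (auto dest: inj_onD)
    ultimately show False using jk(3) s[of j k] by (auto simp: pat_def)
  qed
  then have "distinct (map fst (map (\<lambda>j. (pat j, a j)) [0..<n]))"
    by (simp add: distinct_map o_def atLeast0LessThan)
  then have "map_of (map (\<lambda>j. (pat j, a j)) [0..<n]) (pat j) = Some (a j)" if "j < n" for j
    using that by (intro map_of_is_SomeI) auto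
  then show ?thesis
    by (intro exI[of _ "(S, map (\<lambda>j. (pat j, a j)) [0..<n])"])
       (simp add: separating_value_def pat_def)
qed

text \<open>Uniqueness of base \<open>N\<close> digits, for the Kronecker substitution \<open>y\<^sub>i = t ^ (N ^ i)\<close> below.\<close>

lemma sum_mult_power_inj:
  fixes f g :: "nat \<Rightarrow> nat"
  assumes "\<And>i. i < n \<Longrightarrow> f i < N" "\<And>i. i < n \<Longrightarrow> g i < N"
    and "(\<Sum>i<n. f i * N ^ i) = (\<Sum>i<n. g i * N ^ i)"
  shows "\<forall>i<n. f i = g i"
  using assms
proof (induction n arbitrary: f g)
  case 0
  then show ?case by simp
next
  case (Suc n)
  have split: "(\<Sum>i<Suc n. h i * N ^ i) = h 0 + N * (\<Sum>i<n. h (Suc i) * N ^ i)" for h :: "nat \<Rightarrow> nat"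
    unfolding sum.lessThan_Suc_shift sum_distrib_left by (simp add: mult.left_commute)
  have N: "f 0 < N" "g 0 < N" using Suc.prems by auto
  have eq: "f 0 + N * (\<Sum>i<n. f (Suc i) * N ^ i) = g 0 + N * (\<Sum>i<n. g (Suc i) * N ^ i)"
    using Suc.prems(3) by (simp only: split)
  from arg_cong[OF eq, of "\<lambda>x. x mod N"] N have f0: "f 0 = g 0" by simp
  with eq N have "(\<Sum>i<n. f (Suc i) * N ^ i) = (\<Sum>i<n. g (Suc i) * N ^ i)" by simp
  then have "\<forall>i<n. f (Suc i) = g (Suc i)"
    by (intro Suc.IH Suc.prems(1,2)) auto
  with f0 show ?case by (metis less_Suc_eq_0_disj)
qed

text \<open>With \<open>N\<close> above all exponents, the Kronecker substitution sends distinct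
  monomials to distinct powers of \<open>t\<close>. Hence no terms cancel, and \<open>P\<close>
  becomes a nonzero polynomial in one variable, which has only finitely many roots.\<close>

lemma mpoly_eval_nonzero_near_0:
  assumes P: "in_variables n P" "P \<noteq> 0" and "\<epsilon> > 0"
  obtains a :: "nat \<Rightarrow> real" where "\<And>i. \<bar>a i\<bar> \<le> \<epsilon>" "mpoly_eval a P \<noteq> 0"
proof -
  let ?K = "Poly_Mapping.keys P"
  \<comment> \<open>The inserted \<open>0\<close> keeps \<open>Max\<close> meaningful when
    \<open>n = 0\<close>.\<close>
  define N where "N = Suc (Max (insert 0 ((\<lambda>(m, i). Poly_Mapping.lookup m i) ` (?K \<times> {..<n}))))"
  have N: "Poly_Mapping.lookup m i < N" if "m \<in> ?K" "i < n" for m i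
    unfolding N_def less_Suc_eq_le using that by (intro Max_ge) force+
  define w where "w m = (\<Sum>i<n. Poly_Mapping.lookup m i * N ^ i)" for m
  have w_inj: "m = m'" if m: "m \<in> ?K" "m' \<in> ?K" "w m = w m'" for m m'
  proof (rule poly_mapping_eqI)
    fix i
    have "\<forall>i<n. Poly_Mapping.lookup m i = Poly_Mapping.lookup m' i"
      using m N by (intro sum_mult_power_inj) (auto simp: w_def)
    moreover have "Poly_Mapping.keys m \<subseteq> {..<n}" "Poly_Mapping.keys m' \<subseteq> {..<n}"
      using P(1) m by (auto simp: in_variables_def)
    ultimately show "Poly_Mapping.lookup m i = Poly_Mapping.lookup m' i"
      by (metis in_keys_iff lessThan_iff subsetD)
  qed
  define p where "p = (\<Sum>m\<in>?K. monom (Poly_Mapping.lookup P m) (w m))"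
  obtain m0 where m0: "m0 \<in> ?K" using P(2) by (metis keys_eq_empty all_not_in_conv)
  have "coeff p (w m0) = (\<Sum>m\<in>?K. if m = m0 then Poly_Mapping.lookup P m else 0)"
    unfolding p_def coeff_sum by (intro sum.cong) (use w_inj m0 in auto)
  also have "\<dots> = Poly_Mapping.lookup P m0" using m0 by simp
  finally have "p \<noteq> 0" using m0 by (auto simp: in_keys_iff)
  then have "finite {t. poly p t = 0}" by (rule poly_roots_finite)
  \<comment> \<open>The bound by \<open>1\<close> ensures that the powers of \<open>t\<close> used
    as coordinates are at most \<open>t\<close>.\<close>
  moreover have "infinite {0<..<min 1 \<epsilon>}" using \<open>\<epsilon> > 0\<close> by (simp add: infinite_Ioo)
  ultimately have "\<not> {0<..<min 1 \<epsilon>} \<subseteq> {t. poly p t = 0}" using finite_subset by blast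
  then obtain t where "t \<in> {0<..<min 1 \<epsilon>}" "poly p t \<noteq> 0" by blast
  then have t: "poly p t \<noteq> 0" "0 < t" "t < 1" "t < \<epsilon>" by simp_all
  define a where "a i = t ^ (N ^ i)" for i
  have "monom_eval a m = t ^ w m" if m: "m \<in> ?K" for m
  proof -
    have "monom_eval a m = (\<Prod>i<n. a i ^ Poly_Mapping.lookup m i)"
      unfolding monom_eval_def
      by (intro prod.mono_neutral_left) (use P(1) m in \<open>auto simp: in_variables_def in_keys_iff\<close>)
    also have "\<dots> = t ^ w m"
      by (simp add: a_def w_def power_sum mult.commute flip: power_mult)
    finally show ?thesis .
  qed
  then have "mpoly_eval a P = poly p t"
    by (simp add: mpoly_eval_def p_def poly_sum poly_monom)
  moreover have "\<bar>a i\<bar> \<le> \<epsilon>" for i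
  proof -
    have "N ^ i \<ge> 1" by (simp add: N_def)
    then have "t ^ (N ^ i) \<le> t ^ 1" using t by (intro power_decreasing) auto
    then show ?thesis using t by (simp add: a_def)
  qed
  ultimately show ?thesis using that t(1) by metis
qed

section \<open>Polynomials in functions and independence of free generators\<close>

lemma sum_fun_apply: "(\<Sum>i\<in>I. f i) x = (\<Sum>i\<in>I. f i x)"
  by (induction I rule: infinite_finite_induct) auto

lemma prod_fun_apply: "(\<Prod>i\<in>I. f i) x = (\<Prod>i\<in>I. f i x)"
  by (induction I rule: infinite_finite_induct) auto

lemma power_fun_apply: "(f ^ k) x = f x ^ k"
  by (induction k) auto

lemma mpoly_eval_fun_apply:
  fixes y :: "nat \<Rightarrow> 'a \<Rightarrow> 'b::{real_algebra_1, comm_ring_1}"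
  shows "mpoly_eval y P x = mpoly_eval (\<lambda>i. y i x) P"
  by (simp add: mpoly_eval_def monom_eval_def sum_fun_apply prod_fun_apply power_fun_apply)

lemma mpoly_eval_cong:
  assumes "in_variables n P" "\<And>i. i < n \<Longrightarrow> y i = z i"
  shows "mpoly_eval y P = mpoly_eval z P"
proof -
  have "y i = z i" if "m \<in> Poly_Mapping.keys P" "i \<in> Poly_Mapping.keys m" for m i
    using assms that by (fastforce simp: in_variables_def)
  then show ?thesis
    unfolding mpoly_eval_def monom_eval_def
    by (intro sum.cong prod.cong arg_cong2[where f = scaleR]) simp_all
qed

lemma mpoly_eval_zero:
  assumes "no_constant_term P"
  shows "mpoly_eval (\<lambda>_. 0) P = 0"
  unfolding mpoly_eval_def
proof (rule sum.neutral, rule ballI)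
  fix m assume "m \<in> Poly_Mapping.keys P"
  then have "m \<noteq> 0" using assms by (auto simp: no_constant_term_def in_keys_iff)
  then obtain i where "i \<in> Poly_Mapping.keys m" by fastforce
  then have "monom_eval (\<lambda>_. 0) m = (0::'a)"
    unfolding monom_eval_def by (intro prod_zero bexI[of _ i]) (auto simp: in_keys_iff zero_power)
  then show "Poly_Mapping.lookup P m *\<^sub>R monom_eval (\<lambda>_. 0) m = (0::'a)" by simp
qed

lemma isCont_mpoly_eval:
  fixes y :: "nat \<Rightarrow> 'a::t2_space \<Rightarrow> real"
  assumes "in_variables n P" "\<And>i. i < n \<Longrightarrow> isCont (y i) x"
  shows "isCont (mpoly_eval y P) x"
proof -
  have "isCont (\<lambda>z. mpoly_eval (\<lambda>i. y i z) P) x"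
    unfolding mpoly_eval_def monom_eval_def
    using assms by (intro continuous_intros) (auto simp: in_variables_def)
  then show ?thesis by (simp add: mpoly_eval_fun_apply[symmetric])
qed

text \<open>A linear relation between generators is a polynomial relation of degree one without
  constant term.\<close>

lemma free_imp_independent:
  fixes Y :: "'a::{real_algebra_1, comm_ring_1} set"
  assumes free: "free_generators Y A"
  shows "independent Y"
proof
  assume "dependent Y"
  then obtain T c b where T: "finite T" "T \<subseteq> Y" "(\<Sum>v\<in>T. c v *\<^sub>R v) = 0" "b \<in> T" "c b \<noteq> 0"
    unfolding dependent_explicit by auto
  obtain y where y: "bij_betw y {..<card T} T"
    using ex_bij_betw_nat_finite[OF T(1)] by (auto simp: atLeast0LessThan)
  let ?n = "card T"
  let ?x = "\<lambda>i::nat. Poly_Mapping.single i (1::nat)"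
  have x_inj: "inj ?x"
    by (rule injI) (metis lookup_single_eq lookup_single_not_eq zero_neq_one)
  define P where "P = (\<Sum>i<?n. Poly_Mapping.single (?x i) (c (y i)))"
  have lookup_P: "Poly_Mapping.lookup P m = (\<Sum>i<?n. if m = ?x i then c (y i) else 0)" for m
    by (auto simp: P_def lookup_sum lookup_single when_def intro!: sum.cong)
  have keys_P: "\<exists>i<?n. m = ?x i" if "m \<in> Poly_Mapping.keys P" for m
  proof (rule ccontr)
    assume "\<not> ?thesis"
    then have "Poly_Mapping.lookup P m = 0" unfolding lookup_P by (intro sum.neutral) auto
    with that show False by (simp add: in_keys_iff)
  qed
  have "b \<in> y ` {..<?n}" using y T(4) by (simp add: bij_betw_def)
  then obtain j where j: "j < ?n" "y j = b" by blast
  have "Poly_Mapping.lookup P (?x j) = (\<Sum>i<?n. if i = j then c (y i) else 0)"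
    unfolding lookup_P using inj_eq[OF x_inj] by (intro sum.cong) auto
  then have "P \<noteq> 0" using j T(5) by auto
  moreover have "in_variables ?n P" using keys_P by (fastforce simp: in_variables_def)
  moreover have "no_constant_term P"
  proof -
    have "?x i \<noteq> 0" for i by (metis lookup_single_eq lookup_zero zero_neq_one)
    then show ?thesis using keys_P by (metis in_keys_iff no_constant_term_def)
  qed
  moreover have "mpoly_eval y P = 0"
  proof -
    have "mpoly_eval y (\<Sum>i\<in>I. Poly_Mapping.single (?x i) (c (y i))) = (\<Sum>i\<in>I. c (y i) *\<^sub>R y i)"
      if "finite I" for I
      using that
      by induction (simp_all add: mpoly_eval_add mpoly_eval_single, simp_all add: mpoly_eval_def monom_eval_def)
    then have "mpoly_eval y P = (\<Sum>i<?n. c (y i) *\<^sub>R y i)" by (simp add: P_def)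
    also have "\<dots> = (\<Sum>v\<in>T. c v *\<^sub>R v)" by (rule sum.reindex_bij_betw[OF y])
    finally show ?thesis using T(3) by simp
  qed
  moreover have "inj_on y {..<?n}" "y ` {..<?n} \<subseteq> Y" "?n \<ge> 1"
    using y T j by (auto simp: bij_betw_def)
  ultimately show False using free unfolding free_generators_def by blast
qed

section \<open>Closed sets with enough condensation points\<close>

text \<open>A decomposition of \<open>F\<close> into closed sets \<open>C n\<close> need not do, as
  a point may fail to be a condensation point of every \<open>C n\<close> containing it. Such points
  are countably many in all, so a further closed set for each keeps the family countable.\<close>

lemma fsigma_condensation_cover:
  fixes F :: "real set"
  assumes F: "fsigma_in euclidean F"
    and dense: "\<And>x U. x \<in> F \<Longrightarrow> open U \<Longrightarrow> x \<in> U \<Longrightarrow> uncountable (F \<inter> U)"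
    and "F \<noteq> {}"
  obtains K :: "nat \<Rightarrow> real set"
  where "\<And>n. closed (K n)" "\<And>n. K n \<subseteq> F"
    "\<And>x. x \<in> F \<Longrightarrow> \<exists>n. x \<in> K n \<and> (\<forall>U. open U \<longrightarrow> x \<in> U \<longrightarrow> uncountable (K n \<inter> U))"
proof -
  obtain C :: "nat \<Rightarrow> real set" where C: "\<And>n. closed (C n)" "\<Union> (range C) = F"
    using F unfolding fsigma_in_ascending closed_closedin by metis
  define N where "N n = {x\<in>C n. \<exists>U. open U \<and> x \<in> U \<and> countable (C n \<inter> U)}" for n
  have N: "countable (N n)" for n
    unfolding N_def by (rule countable_noncondensation)
  \<comment> \<open>The countably many points of the \<open>C n\<close> that are not condensation points of \<open>C n\<close> get a closed
    set of their own: uncountable closed pieces of \<open>F\<close> shrinking to the point.\<close>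
  have "\<exists>D. closed D \<and> D \<subseteq> F \<and> x \<in> D \<and> (\<forall>U. open U \<longrightarrow> x \<in> U \<longrightarrow> uncountable (D \<inter> U))"
    if x: "x \<in> F" for x
  proof -
    have "\<exists>E. closed E \<and> E \<subseteq> F \<inter> ball x (1 / real (Suc k)) \<and> uncountable E" for k
    proof -
      let ?V = "F \<inter> ball x (1 / real (Suc k))"
      have "fsigma_in euclidean ?V"
        using F by (rule fsigma_in_Int) (simp add: fsigma_in_open)
      moreover have "uncountable ?V" using dense x by auto
      ultimately show ?thesis using uncountable_fsigma_contains_closed by metis
    qed
    then obtain E where E: "\<And>k. closed (E k)" "\<And>k. E k \<subseteq> F \<inter> ball x (1 / real (Suc k))"
      "\<And>k. uncountable (E k)" by metis
    define D where "D = insert x (\<Union>k. E k)"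
    \<comment> \<open>The sets \<open>E k\<close> shrink to \<open>x\<close>, so near any other
      point only finitely many of them matter.\<close>
    have "closed D" unfolding closed_limpt
    proof (intro allI impI)
      fix z assume z: "z islimpt D"
      show "z \<in> D"
      proof (cases "z = x")
        case False
        obtain k where k: "1 / real (Suc k) < dist x z / 2"
          using False nat_approx_posE[of "dist x z / 2"] by auto
        have sub: "D \<inter> ball z (dist x z / 2) \<subseteq> (\<Union>j\<le>k. E j)"
        proof
          fix w assume w: "w \<in> D \<inter> ball z (dist x z / 2)"
          have wx: "dist x w > dist x z / 2" "dist x w > 0"
            using w dist_triangle[of x z w] False by (auto simp: dist_commute)
          then obtain j where j: "w \<in> E j" using w by (auto simp: D_def)
          then have "dist x w < 1 / real (Suc j)" using E(2)[of j] by auto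
          with wx k have "1 / real (Suc k) < 1 / real (Suc j)" by linarith
          then have "j \<le> k" by (simp add: field_simps)
          with j show "w \<in> (\<Union>j\<le>k. E j)" by auto
        qed
        have "z islimpt (D \<inter> ball z (dist x z / 2))"
          unfolding islimpt_def
        proof (intro allI impI)
          fix T assume "z \<in> T" "open T"
          then have "z \<in> T \<inter> ball z (dist x z / 2)" "open (T \<inter> ball z (dist x z / 2))"
            using False by auto
          then show "\<exists>w\<in>D \<inter> ball z (dist x z / 2). w \<in> T \<and> w \<noteq> z"
            using z unfolding islimpt_def by blast
        qed
        then have "z islimpt (\<Union>j\<le>k. E j)" using sub islimpt_subset by blast
        moreover have "closed (\<Union>j\<le>k. E j)" using E(1) by auto
        ultimately have "z \<in> (\<Union>j\<le>k. E j)" using closed_limpt by blast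
        then show ?thesis by (auto simp: D_def)
      qed (simp add: D_def)
    qed
    moreover have "D \<subseteq> F" "x \<in> D" using E(2) x by (auto simp: D_def)
    moreover have "uncountable (D \<inter> U)" if U: "open U" "x \<in> U" for U
    proof -
      obtain e where e: "e > 0" "ball x e \<subseteq> U" using U openE by blast
      obtain k where k: "1 / real (Suc k) < e" using e(1) nat_approx_posE by metis
      then have "ball x (1 / real (Suc k)) \<subseteq> ball x e" by auto
      then have "E k \<subseteq> D \<inter> U" using E(2)[of k] e(2) by (auto simp: D_def)
      then show ?thesis using E(3) countable_subset by blast
    qed
    ultimately show ?thesis by blast
  qed
  then obtain D where D: "\<And>x. x \<in> F \<Longrightarrow> closed (D x)" "\<And>x. x \<in> F \<Longrightarrow> D x \<subseteq> F"
    "\<And>x. x \<in> F \<Longrightarrow> x \<in> D x"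
    "\<And>x U. x \<in> F \<Longrightarrow> open U \<Longrightarrow> x \<in> U \<Longrightarrow> uncountable (D x \<inter> U)" by metis
  define \<K> where "\<K> = range C \<union> D ` (\<Union>n. N n)"
  have NF: "(\<Union>n. N n) \<subseteq> F" using C(2) by (auto simp: N_def)
  have "countable \<K>" using N by (auto simp: \<K>_def)
  moreover have "\<K> \<noteq> {}" by (auto simp: \<K>_def)
  ultimately obtain K :: "nat \<Rightarrow> real set" where K: "range K = \<K>"
    using uncountable_def by metis
  show ?thesis
  proof (rule that[of K])
    have "closed X \<and> X \<subseteq> F" if X: "X \<in> \<K>" for X
    proof -
      consider n where "X = C n" | x where "x \<in> F" "X = D x"
        using X NF unfolding \<K>_def by blast
      then show ?thesis using C D by cases auto
    qed
    then show "closed (K n)" "K n \<subseteq> F" for n using K by auto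
    fix x assume x: "x \<in> F"
    then obtain n where n: "x \<in> C n" using C(2) by auto
    have "\<exists>X\<in>\<K>. x \<in> X \<and> (\<forall>U. open U \<longrightarrow> x \<in> U \<longrightarrow> uncountable (X \<inter> U))"
    proof (cases "x \<in> N n")
      case True
      then have "D x \<in> \<K>" by (auto simp: \<K>_def)
      then show ?thesis using D(3,4)[OF x] by blast
    next
      case False
      then show ?thesis using n by (intro bexI[of _ "C n"]) (auto simp: \<K>_def N_def)
    qed
    then show "\<exists>n. x \<in> K n \<and> (\<forall>U. open U \<longrightarrow> x \<in> U \<longrightarrow> uncountable (K n \<inter> U))"
      unfolding K[symmetric] by blast
  qed
qed

lemma card_of_prod_le_real:
  assumes "|UNIV :: 'a set| \<le>o |UNIV :: real set|" "|UNIV :: 'b set| \<le>o |UNIV :: real set|"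
  shows "|UNIV :: ('a \<times> 'b) set| \<le>o |UNIV :: real set|"
  unfolding UNIV_Times_UNIV[symmetric]
  using assms by (intro card_of_Sigma_ordLeq_infinite infinite_UNIV_char_0) auto

section \<open>From density of the complement to algebrability\<close>

lemma dense_imp_strongly_algebrable:
  assumes G: "gdelta_in euclidean G" and dense: "continuum_dense_in_itself (- G)"
  shows "strongly_algebrable (continuity_class G) (ctwo ^c |UNIV :: real set| )"
proof -
  define F where "F = - G"
  have F: "fsigma_in euclidean F" using G unfolding F_def by (rule fsigma_complement)
  have F_ne: "F \<noteq> {}"
    using dense unfolding continuum_dense_in_itself_def F_def by (rule conjunct1)
  have F_card: "F \<inter> J = {} \<or> |F \<inter> J| =o |UNIV :: real set|" if "open J" "is_interval J" for J
    using dense[unfolded continuum_dense_in_itself_def, THEN conjunct2, rule_format, of J] that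
    unfolding F_def by simp
  have "uncountable (F \<inter> U)" if x: "x \<in> F" "open U" "x \<in> U" for x U
  proof -
    obtain e where e: "e > 0" "ball x e \<subseteq> U" using x openE by blast
    have "is_interval (ball x e)" by (simp add: is_interval_convex_1)
    moreover have "F \<inter> ball x e \<noteq> {}" using x e by auto
    ultimately have "|F \<inter> ball x e| =o |UNIV :: real set|"
      using F_card[of "ball x e"] by simp
    then have "F \<inter> ball x e \<approx> (UNIV :: real set)" by (simp add: eqpoll_iff_card_of_ordIso)
    then have "uncountable (F \<inter> ball x e)"
      using uncountable_UNIV_real countable_eqpoll eqpoll_sym by blast
    then show ?thesis using e(2) by (meson Int_mono countable_subset subset_refl)
  qed
  then obtain K :: "nat \<Rightarrow> real set"
    where K: "\<And>n. closed (K n)" "\<And>n. K n \<subseteq> F"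
      "\<And>x. x \<in> F \<Longrightarrow> \<exists>n. x \<in> K n \<and> (\<forall>U. open U \<longrightarrow> x \<in> U \<longrightarrow> uncountable (K n \<inter> U))"
    using fsigma_condensation_cover[OF F _ F_ne] by metis
  define h where "h x = (if x \<in> F then 1 / real (Suc (LEAST n. x \<in> K n)) else 0)" for x
  have h_nonneg: "h x \<ge> 0" for x by (simp add: h_def)
  \<comment> \<open>Truncation to \<open>[-h, h]\<close> will thus preserve values of size at most
    \<open>1 / (n + 1)\<close> at points of \<open>K n\<close>.\<close>
  have h_ge: "h x \<ge> 1 / real (Suc n)" if "x \<in> K n" for x n
    using that K(2)[of n] Least_le[of "\<lambda>n. x \<in> K n" n] by (auto simp: h_def field_simps)
  have h_cont: "(h \<longlongrightarrow> 0) (at x)" if x: "x \<in> G" for x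
  proof (rule LIM_I)
    fix e :: real assume "e > 0"
    then obtain n where n: "1 / real (Suc n) < e" using nat_approx_posE by metis
    \<comment> \<open>Near \<open>x\<close> the finitely many closed sets \<open>K 0\<close>, ...,
      \<open>K n\<close> are avoided, which forces \<open>h\<close> to be small.\<close>
    have "open (- (\<Union>j\<le>n. K j))" using K(1) by (intro open_Compl closed_UN) auto
    moreover have "x \<in> - (\<Union>j\<le>n. K j)" using K(2) x by (auto simp: F_def)
    ultimately obtain d where d: "d > 0" "ball x d \<subseteq> - (\<Union>j\<le>n. K j)" using openE by blast
    have "h z < e" if z: "z \<in> ball x d" for z
    proof (cases "z \<in> F")
      case True
      then have "z \<in> K (LEAST n. z \<in> K n)" using K(3) by (metis LeastI_ex)
      then have "(LEAST n. z \<in> K n) > n" using d(2) z by force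
      then have "1 / real (Suc (LEAST n. z \<in> K n)) \<le> 1 / real (Suc n)" by (simp add: field_simps)
      then show ?thesis using n True by (simp add: h_def)
    qed (use \<open>e > 0\<close> in \<open>simp add: h_def\<close>)
    then show "\<exists>s>0. \<forall>z. z \<noteq> x \<and> norm (z - x) < s \<longrightarrow> norm (h z - 0) < e"
      using d(1) h_nonneg by (intro exI[of _ d]) (auto simp: dist_norm norm_minus_commute)
  qed
  obtain \<U> :: "real set set" where \<U>: "countable \<U>" "\<And>C. C \<in> \<U> \<Longrightarrow> open C"
    "\<And>U. open U \<Longrightarrow> \<exists>\<V>. \<V> \<subseteq> \<U> \<and> U = \<Union>\<V>"
    using univ_second_countable by metis
  have "\<U> \<noteq> {}" using \<U>(3)[of UNIV] by auto
  then obtain \<B> :: "nat \<Rightarrow> real set" where range_\<B>: "range \<B> = \<U>"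
    using \<U>(1) uncountable_def by metis
  have \<B>: "open (\<B> k)" for k using \<U>(2) range_\<B> by blast
  have basis: "\<exists>k. x \<in> \<B> k \<and> \<B> k \<subseteq> U" if "open U" "x \<in> U" for U x
    using \<U>(3)[OF that(1)] that(2) unfolding range_\<B>[symmetric] by blast
  \<comment> \<open>The value \<open>UNIV\<close> merely fills the irrelevant indices with a set of size continuum.\<close>
  define W where "W = (\<lambda>(n, k). if uncountable (K n \<inter> \<B> k) then K n \<inter> \<B> k else UNIV)"
  \<comment> \<open>There are at most continuum many indices, so every set \<open>W p\<close> has
    room for all of them.\<close>
  let ?I = "UNIV :: (real list \<times> (bool list \<times> real) list) set"
  have I: "|?I| \<le>o |UNIV :: real set|"
    by (intro card_of_prod_le_real card_of_list_le_real countable_card_le_real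
        card_of_mono1[of "UNIV :: real set" UNIV]) auto
  have "|W p| =o |UNIV :: real set|" for p
  proof (cases p)
    case (Pair n k)
    have "fsigma_in euclidean (K n \<inter> \<B> k)"
      using K(1) \<B> by (intro fsigma_in_Int[OF closed_imp_fsigma_in fsigma_in_open]) auto
    then show ?thesis unfolding W_def Pair using uncountable_fsigma_card card_of_refl by auto
  qed
  then have "|?I| \<le>o |W p|" for p
    using ordIso_symmetric ordLeq_ordIso_trans I by blast
  moreover have "infinite ?I" by (simp add: infinite_UNIV_listI finite_prod)
  ultimately obtain \<sigma> :: "real \<Rightarrow> real list \<times> (bool list \<times> real) list"
    where \<sigma>: "\<And>p. \<sigma> ` W p = UNIV"
    using common_surjection[of W] by blast
  \<comment> \<open>The generators are indexed by all sets of reals. Evaluation at the index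
    \<open>\<sigma> x\<close> gives independence on every \<open>W p\<close>; the truncation gives
    continuity on \<open>G\<close>, where \<open>h\<close> tends to \<open>0\<close>.\<close>
  define y where "y X x = max (- h x) (min (h x) (separating_value X (\<sigma> x)))" for X x
  have y_le: "\<bar>y X x\<bar> \<le> h x" for X x using h_nonneg[of x] by (auto simp: y_def)
  have y_surj: "\<exists>z\<in>U. \<forall>j<m. y (X j) z = a j"
    if X: "inj_on X {..<m}" and a: "\<And>j. \<bar>a j\<bar> \<le> 1 / real (Suc n)"
      and U: "open U" "x \<in> U" and x: "\<And>V. open V \<Longrightarrow> x \<in> V \<Longrightarrow> uncountable (K n \<inter> V)"
    for X :: "nat \<Rightarrow> real set" and m a n x U
  proof -
    obtain i where i: "\<And>j. j < m \<Longrightarrow> separating_value (X j) i = a j"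
      using separating_value_surj[OF X, of a] by blast
    obtain k where k: "x \<in> \<B> k" "\<B> k \<subseteq> U" using basis[OF U] by blast
    have "W (n, k) = K n \<inter> \<B> k" using x[OF \<B> k(1)] by (simp add: W_def)
    moreover obtain z where "z \<in> W (n, k)" "\<sigma> z = i" using \<sigma>[of "(n, k)"] by (metis UNIV_I imageE)
    ultimately have z: "z \<in> K n" "z \<in> U" "\<sigma> z = i" using k(2) by auto
    have "y (X j) z = a j" if "j < m" for j
    proof -
      have "- h z \<le> a j" "a j \<le> h z" using a[of j] h_ge[OF z(1)] by linarith+
      then show ?thesis using i[OF that] z(3) by (simp add: y_def)
    qed
    with z(2) show ?thesis by blast
  qed
  have y_cont: "isCont (y X) x" "y X x = 0" if "x \<in> G" for X x
  proof -
    show "y X x = 0" using y_le[of X x] that by (simp add: h_def F_def)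
    moreover have "((y X) \<longlongrightarrow> 0) (at x)"
      by (rule Lim_null_comparison[OF _ h_cont[OF that]]) (simp add: y_le)
    ultimately show "isCont (y X) x" by (simp add: isCont_def)
  qed
  have poly: "mpoly_eval (\<lambda>j. y (X j)) P \<in> continuity_class G - {0}"
    if X: "inj_on X {..<m}" and P: "in_variables m P" "no_constant_term P" "P \<noteq> 0" for X m P
  proof -
    let ?f = "mpoly_eval (\<lambda>j. y (X j)) P"
    \<comment> \<open>The value \<open>0\<close> comes from the zero tuple, as \<open>P\<close> has
      no constant term, and \<open>c\<close> from a small tuple at which \<open>P\<close> does not
      vanish.\<close>
    have osc: "\<exists>c\<noteq>0. \<forall>U. open U \<longrightarrow> x \<in> U \<longrightarrow> (\<exists>z\<in>U. ?f z = 0) \<and> (\<exists>z\<in>U. ?f z = c)"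
      if x: "x \<in> F" for x
    proof -
      obtain n where n: "\<And>V. open V \<Longrightarrow> x \<in> V \<Longrightarrow> uncountable (K n \<inter> V)"
        using K(3)[OF x] by blast
      obtain a where a: "\<And>i. \<bar>a i\<bar> \<le> 1 / real (Suc n)" "mpoly_eval a P \<noteq> 0"
        using mpoly_eval_nonzero_near_0[OF P(1,3), of "1 / real (Suc n)"]
        by (metis of_nat_0_less_iff zero_less_Suc zero_less_divide_1_iff)
      have attain: "\<exists>z\<in>U. ?f z = mpoly_eval b P"
        if b: "\<And>i. \<bar>b i\<bar> \<le> 1 / real (Suc n)" "open U" "x \<in> U" for b U
      proof -
        have "\<exists>z\<in>U. \<forall>j<m. y (X j) z = b j" using X b n by (rule y_surj)
        then obtain z where "z \<in> U" "\<And>j. j < m \<Longrightarrow> y (X j) z = b j" by blast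
        then show ?thesis
          using mpoly_eval_cong[OF P(1), of "\<lambda>j. y (X j) z" b] by (auto simp: mpoly_eval_fun_apply)
      qed
      have "\<exists>z\<in>U. ?f z = 0" if "open U" "x \<in> U" for U
        using attain[of "\<lambda>_. 0" U] that mpoly_eval_zero[OF P(2), where 'a = real] by simp
      moreover have "\<exists>z\<in>U. ?f z = mpoly_eval a P" if "open U" "x \<in> U" for U
        using attain[OF a(1) that] .
      ultimately show ?thesis using a(2) by (intro exI[of _ "mpoly_eval a P"]) simp
    qed
    have "isCont ?f x" if "x \<in> G" for x
      using y_cont that by (intro isCont_mpoly_eval[OF P(1)]) auto
    moreover have "\<not> isCont ?f x" if "x \<in> F" for x
    proof
      assume cont: "isCont ?f x"
      obtain c where c: "c \<noteq> 0"
        "\<And>U. open U \<Longrightarrow> x \<in> U \<Longrightarrow> (\<exists>z\<in>U. ?f z = 0) \<and> (\<exists>z\<in>U. ?f z = c)"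
        using osc[OF \<open>x \<in> F\<close>] by blast
      have "\<bar>c\<bar> / 2 > 0" using c(1) by simp
      then have "\<exists>d>0. \<forall>z. dist z x < d \<longrightarrow> dist (?f z) (?f x) < \<bar>c\<bar> / 2"
        using cont unfolding continuous_at_eps_delta by blast
      then obtain d where d: "d > 0" "\<And>z. dist z x < d \<Longrightarrow> dist (?f z) (?f x) < \<bar>c\<bar> / 2" by blast
      obtain z w where zw: "z \<in> ball x d" "?f z = 0" "w \<in> ball x d" "?f w = c"
        using c(2)[of "ball x d"] d(1) by auto
      then have "dist 0 (?f x) < \<bar>c\<bar> / 2" "dist c (?f x) < \<bar>c\<bar> / 2"
        using d(2)[of z] d(2)[of w] by (simp_all add: dist_commute)
      then show False unfolding dist_real_def by linarith
    qed
    ultimately have "?f \<in> continuity_class G"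
      unfolding continuity_class_def F_def by blast
    moreover have "?f \<noteq> 0"
    proof -
      obtain x where "x \<in> F" using F_ne by blast
      then obtain c z where "c \<noteq> 0" "?f z = c" using osc[of x] by (metis UNIV_I open_UNIV)
      then show ?thesis by auto
    qed
    ultimately show ?thesis by blast
  qed
  have y_inj: "inj y"
  proof (rule injI, rule ccontr)
    fix X X' assume eq: "y X = y X'" "X \<noteq> X'"
    obtain x where "x \<in> F" using F_ne by blast
    then obtain n where n: "\<And>V. open V \<Longrightarrow> x \<in> V \<Longrightarrow> uncountable (K n \<inter> V)"
      using K(3) by metis
    \<comment> \<open>Two different index sets can be given the different values \<open>0\<close>
      and \<open>1 / (n + 1)\<close> at one point, so their functions differ.\<close>
    define Z where "Z j = (if j = 0 then X else X')" for j :: nat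
    define a where "a j = (if j = 0 then 0 else 1 / real (Suc n))" for j :: nat
    have "inj_on Z {..<2}" using eq(2) by (auto simp: inj_on_def Z_def less_2_cases_iff)
    moreover have "\<bar>a j\<bar> \<le> 1 / real (Suc n)" for j by (simp add: a_def)
    ultimately have "\<exists>z\<in>UNIV. \<forall>j<2. y (Z j) z = a j"
      using open_UNIV UNIV_I[of x] n by (rule y_surj)
    then obtain z where z: "\<And>j. j < 2 \<Longrightarrow> y (Z j) z = a j" by blast
    from z[of 0] z[of 1] eq(1) show False by (simp add: Z_def a_def)
  qed
  have card: "|range y| =o ctwo ^c |UNIV :: real set|"
  proof -
    have "|range y| =o |UNIV :: real set set|"
      using y_inj card_of_ordIso[of UNIV "range y"] ordIso_symmetric by (metis bij_betw_imageI)
    also have "|UNIV :: real set set| =o ctwo ^c |UNIV :: real set|"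
      using card_of_Pow_Func[of "UNIV :: real set"] by (simp add: cexp_def ctwo_def Field_card_of)
    finally show ?thesis .
  qed
  have tuple: "mpoly_eval f P \<in> continuity_class G - {0}"
    if f: "inj_on f {..<m}" "f ` {..<m} \<subseteq> range y"
      and P: "in_variables m P" "no_constant_term P" "P \<noteq> 0" for f m P
  proof -
    \<comment> \<open>Tuples of distinct generators are pulled back to tuples of distinct index
      sets, where \<open>poly\<close> applies.\<close>
    define X where "X j = inv y (f j)" for j
    have yX: "y (X j) = f j" if "j < m" for j
      using f(2) that by (auto simp: X_def intro!: f_inv_into_f)
    have "inj_on X {..<m}"
      by (rule inj_onI) (metis f(1) inj_onD lessThan_iff yX)
    moreover have "mpoly_eval f P = mpoly_eval (\<lambda>j. y (X j)) P"
      using yX by (intro mpoly_eval_cong[OF P(1)]) auto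
    ultimately show ?thesis using poly P by metis
  qed
  have "range y \<subseteq> continuity_class G"
  proof
    fix f assume f: "f \<in> range y"
    \<comment> \<open>Evaluating the polynomial that is a single variable shows that the generators
      themselves lie in the class.\<close>
    let ?P = "Poly_Mapping.single (Poly_Mapping.single 0 1) 1 :: real_mpoly"
    have "?P \<noteq> 0" by (metis lookup_single_eq lookup_zero zero_neq_one)
    moreover have "Poly_Mapping.single (0::nat) (1::nat) \<noteq> 0"
      by (metis lookup_single_eq lookup_zero zero_neq_one)
    ultimately have "mpoly_eval (\<lambda>_. f) ?P \<in> continuity_class G - {0}"
      using f by (intro tuple[of _ 1])
        (auto simp: in_variables_def no_constant_term_def lookup_single when_def inj_on_def)
    then show "f \<in> continuity_class G" by (simp add: mpoly_eval_single monom_eval_def)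
  qed
  with card tuple show ?thesis
    unfolding strongly_algebrable_iff_polynomial by (intro exI[of _ "range y"]) blast
qed

section \<open>From algebrability to lineability, and from lineability to density\<close>

text \<open>Free generators are linearly independent, so a subset of them of size
  \<open>\<mu>\<close> is a basis of a subspace inside the algebra.\<close>

lemma strongly_algebrable_imp_lineable:
  fixes E :: "'a::{real_algebra_1, comm_ring_1} set"
  assumes "strongly_algebrable E \<kappa>" "\<mu> \<le>o \<kappa>" "Card_order \<mu>"
  shows "lineable E \<mu>"
proof -
  obtain A Y where A: "real_subalgebra A" "A \<subseteq> E \<union> {0}" "free_generators Y A" "|Y| =o \<kappa>"
    using assms(1) unfolding strongly_algebrable_def by blast
  have "\<mu> \<le>o |Y|" using assms(2) A(4) ordIso_symmetric ordLeq_ordIso_trans by blast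
  moreover have "|Field \<mu>| =o \<mu>" using assms(3) by (rule card_of_Field_ordIso)
  ultimately have "|Field \<mu>| \<le>o |Y|" using ordIso_ordLeq_trans by blast
  then obtain f where f: "inj_on f (Field \<mu>)" "f ` Field \<mu> \<subseteq> Y"
    using card_of_ordLeq[of "Field \<mu>" Y] by auto
  define B where "B = f ` Field \<mu>"
  have "|B| =o |Field \<mu>|"
    using f(1) card_of_ordIso[of "Field \<mu>" B] ordIso_symmetric
    unfolding B_def by (metis bij_betw_imageI)
  then have "|B| =o \<mu>" using \<open>|Field \<mu>| =o \<mu>\<close> ordIso_transitive by blast
  moreover have "independent B"
    using free_imp_independent[OF A(3)] f(2) independent_mono B_def by blast
  moreover have "span B \<subseteq> E \<union> {0}"
  proof -
    have "Y \<subseteq> A" using A(3) hull_subset[of Y real_subalgebra] by (simp add: free_generators_def)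
    then have "span B \<subseteq> A"
      using A(1) f(2) by (intro span_minimal) (auto simp: B_def real_subalgebra_def)
    then show ?thesis using A(2) by blast
  qed
  ultimately show ?thesis unfolding lineable_def using subspace_span by blast
qed

text \<open>There are at most continuum many restrictions to \<open>S\<close>, so two of the more
  numerous basis elements agree on \<open>S\<close>. Their difference is the required
  function.\<close>

lemma lineable_vanishing_on_countable:
  fixes E :: "('a \<Rightarrow> real) set"
  assumes E: "lineable E (cardSuc |UNIV :: real set| )" and S: "countable S"
  obtains f where "f \<in> E" "f \<noteq> 0" "\<And>x. x \<in> S \<Longrightarrow> f x = 0"
proof -
  obtain V B where V: "subspace V" "V \<subseteq> E \<union> {0}" "span B = V"
    and B: "|B| =o cardSuc |UNIV :: real set|"
    using E unfolding lineable_def by blast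
  define \<rho> where "\<rho> f = (\<lambda>n. if S = {} then 0 else f (from_nat_into S n))" for f :: "'a \<Rightarrow> real"
  have "\<not> inj_on \<rho> B"
  proof
    assume "inj_on \<rho> B"
    then have "|B| \<le>o |UNIV :: (nat \<Rightarrow> real) set|"
      using card_of_ordLeq[of B "UNIV :: (nat \<Rightarrow> real) set"] by auto
    then have "|B| \<le>o |UNIV :: real set|" using card_of_nat_fun_real ordLeq_transitive by blast
    then have "cardSuc |UNIV :: real set| \<le>o |UNIV :: real set|"
      using B ordIso_symmetric ordIso_ordLeq_trans by blast
    then show False
      using cardSuc_greater[OF card_of_Card_order] not_ordLess_ordLeq by blast
  qed
  then obtain f g where fg: "f \<in> B" "g \<in> B" "f \<noteq> g" "\<rho> f = \<rho> g" by (auto simp: inj_on_def)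
  have "f x = g x" if x: "x \<in> S" for x
  proof -
    have "S \<noteq> {}" using x by blast
    then show ?thesis
      using fun_cong[OF fg(4), of "to_nat_on S x"] from_nat_into_to_nat_on[OF S x]
      by (simp add: \<rho>_def)
  qed
  moreover have "f - g \<in> V" using fg V span_base[of _ B] by (auto intro: subspace_diff)
  moreover have "f - g \<noteq> 0" using fg by simp
  ultimately show ?thesis using V(2) by (intro that[of "f - g"]) auto
qed

lemma lineable_imp_dense:
  assumes G: "gdelta_in euclidean G"
    and lin: "lineable (continuity_class G) (cardSuc |UNIV :: real set| )"
  shows "continuum_dense_in_itself (- G)"
proof (rule ccontr)
  assume not_dense: "\<not> continuum_dense_in_itself (- G)"
  \<comment> \<open>The alternative \<open>J = UNIV\<close> covers an empty complement; there the
    contradiction will come from \<open>f\<close> being zero everywhere.\<close>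
  obtain J where J: "open J" "countable (- G \<inter> J)" "- G \<inter> J \<noteq> {} \<or> J = UNIV"
  proof (cases "- G = {}")
    case True
    then show ?thesis using that[of UNIV] by auto
  next
    case False
    then obtain J where J: "open J" "- G \<inter> J \<noteq> {}" "\<not> |- G \<inter> J| =o |UNIV :: real set|"
      using not_dense unfolding continuum_dense_in_itself_def by blast
    have "fsigma_in euclidean (- G \<inter> J)"
      using G J(1) by (intro fsigma_in_Int[OF fsigma_complement fsigma_in_open])
    then have "countable (- G \<inter> J)" using uncountable_fsigma_card J(3) by blast
    with J that show ?thesis by blast
  qed
  \<comment> \<open>Vanishing on the countable set \<open>Q \<union> (- G \<inter> J)\<close> forces
    \<open>f\<close> to vanish on \<open>J\<close>: at points of \<open>G\<close> by continuity
    along a sequence in \<open>Q\<close>, at the others directly.\<close>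
  obtain Q where Q: "countable Q" "Q \<subseteq> G \<inter> J" "G \<inter> J \<subseteq> closure Q"
    using separable[of "G \<inter> J"] .
  obtain f where f: "f \<in> continuity_class G" "f \<noteq> 0" "\<And>x. x \<in> Q \<union> (- G \<inter> J) \<Longrightarrow> f x = 0"
    using lineable_vanishing_on_countable[OF lin] Q(1) J(2) by (metis countable_Un)
  have cont: "isCont f x \<longleftrightarrow> x \<in> G" for x using f(1) by (auto simp: continuity_class_def)
  have zero: "f x = 0" if x: "x \<in> J" for x
  proof (cases "x \<in> G")
    case True
    then have "x \<in> closure Q" using Q(3) x by auto
    then obtain s where s: "\<And>n. s n \<in> Q" "s \<longlonglongrightarrow> x" by (auto simp: closure_sequential)
    have "(\<lambda>n. f (s n)) \<longlonglongrightarrow> f x" using True s(2) cont isCont_tendsto_compose by blast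
    moreover have "(\<lambda>n. f (s n)) = (\<lambda>n. 0)" using s(1) f(3) by auto
    ultimately show ?thesis using LIMSEQ_unique tendsto_const by metis
  qed (use f(3) x in auto)
  have "isCont f x" if "x \<in> J" for x
  proof -
    have "eventually (\<lambda>z. z \<in> J) (nhds x)" using J(1) that by (rule eventually_nhds_in_open)
    then have "eventually (\<lambda>z. f z = 0) (nhds x)" by eventually_elim (rule zero)
    then show ?thesis using isCont_cong[of f "\<lambda>_. 0" x] by simp
  qed
  \<comment> \<open>This excludes that \<open>J\<close> meets the complement of \<open>G\<close>,
    which leaves only the alternative \<open>J = UNIV\<close>.\<close>
  then have "J \<subseteq> G" using cont by auto
  then have "J = UNIV" using J(3) by auto
  then show False using zero f(2) by (auto simp: fun_eq_iff)
qed

theorem theorem3p10: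
  fixes G :: "real set"
  assumes "gdelta_in euclidean G"
  shows "(strongly_algebrable (continuity_class G) (ctwo ^c |UNIV :: real set| )
            \<longleftrightarrow> lineable (continuity_class G) (cardSuc |UNIV :: real set| ))
       \<and> (lineable (continuity_class G) (cardSuc |UNIV :: real set| )
            \<longleftrightarrow> continuum_dense_in_itself (- G))"
proof -
  \<comment> \<open>Cantor's theorem supplies the inequality that carries algebrability to
    lineability; the two remaining implications close the cycle.\<close>
  have "cardSuc |UNIV :: real set| \<le>o ctwo ^c |UNIV :: real set|"
    by (intro cardSuc_least ordLess_ctwo_cexp card_of_Card_order Card_order_cexp)
  then have "strongly_algebrable (continuity_class G) (ctwo ^c |UNIV :: real set| )
      \<Longrightarrow> lineable (continuity_class G) (cardSuc |UNIV :: real set| )"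
    using strongly_algebrable_imp_lineable cardSuc_Card_order[OF card_of_Card_order] by blast
  then show ?thesis
    using lineable_imp_dense[OF assms] dense_imp_strongly_algebrable[OF assms] by blast
qed

end
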